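(* For every integer $d\ge3$, there exists a nonnegatively weighted exact Max-Cut instance with connected support graph whose optimal dual slack has rank $d$, is not completely positive, and has a kernel spanned by optimal cut sign vectors.
   Context: A nonnegatively weighted Max-Cut instance on $n\ge2$ vertices is a symmetric entrywise nonnegative $W\in\mathbb R^{n\times n}$ with zero diagonal; its support graph on $\{1,\dots,n\}$ has edges $\{i,j\}$ with $W_{ij}>0$ and is assumed to have no isolated vertices. Put $\operatorname{MC}(W)=\max_{x\in\{-1,1\}^n}\frac14\sum_{i\ne j}W_{ij}(1-x_ix_j)$ and $\operatorname{SDP}(W)=\max\{\frac14\sum_{i\ne j}W_{ij}(1-X_{ij}):X\succeq0,\ X_{ii}=1\ \forall i\}$. The instance is exact if $\operatorname{MC}(W)=\operatorname{SDP}(W)$. An optimal cut sign vector is an $x\in\{-1,1\}^n$ attaining $\operatorname{MC}(W)$. With $\delta_i=\sum_jW_{ij}$ and $L_W=\operatorname{Diag}(\delta)-W$, the dual problem is $\min\{\mathbf 1^\top s: Z(s)=\operatorname{Diag}(s)-\frac14L_W\succeq0\}$. For an exact instance the dual optimal solution $s$ is unique, and the corresponding $Z(s)$ is the optimal dual slack. A symmetric matrix is completely positive if it equals $N^\top N$ for some entrywise nonnegative matrix $N$. *)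

theory Defs
  imports
    "Jordan_Normal_Form.Matrix_Kernel"
    "Jordan_Normal_Form.DL_Rank"
    "Graph_Theory.Digraph_Component"
begin

text \<open>Vertices are \<open>0, \<dots>, n - 1\<close>, following the indexing of matrices and vectors.\<close>

definition psd :: "nat \<Rightarrow> real mat \<Rightarrow> bool" where
  "psd n A \<longleftrightarrow> A \<in> carrier_mat n n \<and> A\<^sup>T = A \<and> (\<forall>v \<in> carrier_vec n. v \<bullet> (A *\<^sub>v v) \<ge> 0)"

definition completely_positive :: "nat \<Rightarrow> real mat \<Rightarrow> bool" where
  "completely_positive n A \<longleftrightarrow>
    (\<exists>k. \<exists>N \<in> carrier_mat k n. (\<forall>i<k. \<forall>j<n. N $$ (i, j) \<ge> 0) \<and> A = N\<^sup>T * N)"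

definition support_graph :: "nat \<Rightarrow> real mat \<Rightarrow> nat pair_pre_digraph" where
  "support_graph n W = \<lparr> pverts = {..<n}, parcs = {(i, j). i < n \<and> j < n \<and> W $$ (i, j) > 0} \<rparr>"

definition maxcut_instance :: "nat \<Rightarrow> real mat \<Rightarrow> bool" where
  "maxcut_instance n W \<longleftrightarrow>
    n \<ge> 2 \<and> W \<in> carrier_mat n n \<and> W\<^sup>T = W \<and>
    (\<forall>i<n. \<forall>j<n. W $$ (i, j) \<ge> 0) \<and> (\<forall>i<n. W $$ (i, i) = 0) \<and>
    (\<forall>i \<in> pverts (support_graph n W). \<exists>j. (i, j) \<in> parcs (support_graph n W))"

definition sign_vecs :: "nat \<Rightarrow> real vec set" where
  "sign_vecs n = {x \<in> carrier_vec n. \<forall>i<n. x $ i \<in> {-1, 1}}"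

definition cut_value :: "nat \<Rightarrow> real mat \<Rightarrow> real vec \<Rightarrow> real" where
  "cut_value n W x = 1 / 4 * (\<Sum>i<n. \<Sum>j\<in>{..<n} - {i}. W $$ (i, j) * (1 - x $ i * x $ j))"

definition MC :: "nat \<Rightarrow> real mat \<Rightarrow> real" where
  "MC n W = Max (cut_value n W ` sign_vecs n)"

definition optimal_cuts :: "nat \<Rightarrow> real mat \<Rightarrow> real vec set" where
  "optimal_cuts n W = {x \<in> sign_vecs n. cut_value n W x = MC n W}"

definition sdp_value :: "nat \<Rightarrow> real mat \<Rightarrow> real mat \<Rightarrow> real" where
  "sdp_value n W X = 1 / 4 * (\<Sum>i<n. \<Sum>j\<in>{..<n} - {i}. W $$ (i, j) * (1 - X $$ (i, j)))"

definition sdp_feasible :: "nat \<Rightarrow> real mat set" where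
  "sdp_feasible n = {X. psd n X \<and> (\<forall>i<n. X $$ (i, i) = 1)}"

text \<open>The supremum is a maximum: the feasible set is nonempty and compact.\<close>

definition SDP :: "nat \<Rightarrow> real mat \<Rightarrow> real" where
  "SDP n W = (SUP X \<in> sdp_feasible n. sdp_value n W X)"

definition exact_instance :: "nat \<Rightarrow> real mat \<Rightarrow> bool" where
  "exact_instance n W \<longleftrightarrow> maxcut_instance n W \<and> MC n W = SDP n W"

definition laplacian :: "nat \<Rightarrow> real mat \<Rightarrow> real mat" where
  "laplacian n W = mat_diag n (\<lambda>i. \<Sum>j<n. W $$ (i, j)) - W"

definition dual_slack :: "nat \<Rightarrow> real mat \<Rightarrow> real vec \<Rightarrow> real mat" where
  "dual_slack n W s = mat_diag n (\<lambda>i. s $ i) - (1 / 4) \<cdot>\<^sub>m laplacian n W"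

definition dual_feasible :: "nat \<Rightarrow> real mat \<Rightarrow> real vec set" where
  "dual_feasible n W = {s \<in> carrier_vec n. psd n (dual_slack n W s)}"

definition dual_optimal :: "nat \<Rightarrow> real mat \<Rightarrow> real vec \<Rightarrow> bool" where
  "dual_optimal n W s \<longleftrightarrow>
    s \<in> dual_feasible n W \<and> (\<forall>t \<in> dual_feasible n W. (\<Sum>i<n. s $ i) \<le> (\<Sum>i<n. t $ i))"

text \<open>The slack of the unique dual optimal solution. Uniqueness is a theorem for exact instances;
  it is required here so that \<open>Z\<close> is determined by \<open>W\<close>.\<close>

definition is_optimal_dual_slack :: "nat \<Rightarrow> real mat \<Rightarrow> real mat \<Rightarrow> bool" where
  "is_optimal_dual_slack n W Z \<longleftrightarrow>
    (\<exists>s. dual_optimal n W s \<and> (\<forall>t. dual_optimal n W t \<longrightarrow> t = s) \<and> Z = dual_slack n W s)"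

abbreviation vec_span :: "nat \<Rightarrow> real vec set \<Rightarrow> real vec set" where
  "vec_span n \<equiv> LinearCombinations.module.span class_ring (module_vec TYPE(real) n)"

end

theory Submission
  imports Defs
begin

text \<open>
  Off the diagonal a dual slack is \<open>W / 4\<close>, so every positive semidefinite matrix \<open>Z\<close> with nonnegative
  entries is the dual slack of some nonnegative weights.  If the kernel of \<open>Z\<close> contains a sign vector,
  that vector and the dual solution attain the same value; the instance is then exact, \<open>Z\<close> is its unique optimal slack
  and the optimal cuts are the sign vectors in the kernel (\<open>exact_from_gram_slack\<close>).  The task is therefore to
  find a connected doubly nonnegative matrix of rank \<open>d\<close> that is not completely positive and whose
  kernel is spanned by sign vectors.

  The obstruction to complete positivity is a pentagon of vectors in three-space: five vectors with nonnegative
  inner products, orthogonal exactly when cyclically consecutive.  A nonnegative vector in the row space of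
  their Gram matrix whose support contains no orthogonal pair must vanish
  (\<open>pentagon_not_completely_positive\<close>).  Adding one vector for each further dimension, each with the
  inner products of a pentagon vector, gives rank \<open>d\<close> and keeps the support graph connected.

  This configuration has integer relations but no relation with all coefficients \<open>\<plusminus>1\<close>.  Repeating
  every vector repairs this without changing the rank or the obstruction: with \<open>2 * m\<close> copies, any
  relation with integer coefficients bounded by \<open>m\<close> can be spread over the copies with signs only, and sign
  vectors also generate the differences between copies (\<open>blow_up_kernel_spanned_by_signs\<close>).
\<close>

section \<open>Gram matrices and positive semidefinite forms\<close>

lemma scalar_prod_self_zero:
  fixes v :: "real vec"
  assumes "v \<in> carrier_vec n" and "v \<bullet> v = 0"
  shows "v = 0\<^sub>v n"
proof (rule eq_vecI)
  fix i assume "i < dim_vec (0\<^sub>v n :: real vec)"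
  then have i: "i < n" by simp
  have "(\<Sum>i\<in>{0..<n}. v $ i * v $ i) = 0"
    using assms by (simp add: scalar_prod_def)
  then have "\<forall>i\<in>{0..<n}. v $ i * v $ i = 0"
    by (subst (asm) sum_nonneg_eq_0_iff) auto
  then show "v $ i = (0\<^sub>v n :: real vec) $ i" using i by simp
qed (use assms in simp)

lemma gram_quadratic_form:
  fixes V :: "real mat"
  assumes "V \<in> carrier_mat d n" and "v \<in> carrier_vec n"
  shows "v \<bullet> ((V\<^sup>T * V) *\<^sub>v v) = (V *\<^sub>v v) \<bullet> (V *\<^sub>v v)"
proof -
  have "(V\<^sup>T * V) *\<^sub>v v = V\<^sup>T *\<^sub>v (V *\<^sub>v v)"
    using assms by (intro assoc_mult_mat_vec) auto
  moreover have "v \<bullet> (V\<^sup>T *\<^sub>v (V *\<^sub>v v)) = (V\<^sup>T *\<^sub>v (V *\<^sub>v v)) \<bullet> v"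
    using assms by (intro comm_scalar_prod[of _ n]) auto
  moreover have "(V\<^sup>T *\<^sub>v (V *\<^sub>v v)) \<bullet> v = (V *\<^sub>v v) \<bullet> (V *\<^sub>v v)"
    using assms transpose_vec_mult_scalar[of V d n v "V *\<^sub>v v"] by auto
  ultimately show ?thesis by simp
qed

lemma gram_psd:
  fixes V :: "real mat"
  assumes V: "V \<in> carrier_mat d n"
  shows "psd n (V\<^sup>T * V)"
  unfolding psd_def
proof (intro conjI ballI)
  show "(V\<^sup>T * V)\<^sup>T = V\<^sup>T * V" using V by (simp add: transpose_mult)
  fix v :: "real vec" assume v: "v \<in> carrier_vec n"
  show "v \<bullet> ((V\<^sup>T * V) *\<^sub>v v) \<ge> 0"
    unfolding gram_quadratic_form[OF V v] by (simp add: scalar_prod_def sum_nonneg)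
qed (use V in auto)

lemma mat_kernel_gram:
  fixes V :: "real mat"
  assumes V: "V \<in> carrier_mat d n"
  shows "mat_kernel (V\<^sup>T * V) = mat_kernel V"
proof (intro equalityI subsetI)
  fix x assume "x \<in> mat_kernel (V\<^sup>T * V)"
  then have x: "x \<in> carrier_vec n" and "(V\<^sup>T * V) *\<^sub>v x = 0\<^sub>v n"
    using V mat_kernel[of "V\<^sup>T * V" n n] by auto
  then have "(V *\<^sub>v x) \<bullet> (V *\<^sub>v x) = 0"
    using gram_quadratic_form[OF V x] by simp
  then have "V *\<^sub>v x = 0\<^sub>v d"
    using V x scalar_prod_self_zero[of "V *\<^sub>v x" d] by auto
  then show "x \<in> mat_kernel V" using V x mat_kernel by blast
next
  fix x assume "x \<in> mat_kernel V"
  then show "x \<in> mat_kernel (V\<^sup>T * V)"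
    using mat_kernel_mult_subset[of V d n "V\<^sup>T" n] V by auto
qed

text \<open>A right inverse \<open>R\<close> expresses that the rows of \<open>V\<close> are independent.  It gives
  \<open>V\<^sup>T * V * R = V\<^sup>T\<close>, so the Gram matrix has the column space of \<open>V\<^sup>T\<close>, a matrix with a left
  inverse and hence with independent columns.\<close>

lemma rank_gram:
  fixes V R :: "real mat"
  assumes V: "V \<in> carrier_mat d n" and R: "R \<in> carrier_mat n d" and VR: "V * R = 1\<^sub>m d"
  shows "vec_space.rank n (V\<^sup>T * V) = d"
proof -
  interpret vec_space "TYPE(real)" n .
  have Vt: "V\<^sup>T \<in> carrier_mat n d" and Z: "V\<^sup>T * V \<in> carrier_mat n n" using V by auto
  have RtVt: "R\<^sup>T * V\<^sup>T = 1\<^sub>m d"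
    using arg_cong[OF VR, of transpose_mat] transpose_mult[OF V R] by simp
  have ZR: "V\<^sup>T * V * R = V\<^sup>T"
    using assoc_mult_mat[OF Vt V R] VR Vt by simp
  have "col_space (V\<^sup>T * V) = col_space (V\<^sup>T)"
    unfolding col_space_eq[OF Vt] col_space_eq[OF Z]
  proof (intro equalityI subsetI; clarsimp)
    fix x :: "real vec" assume x: "x \<in> carrier_vec (dim_col V)"
    then have "V\<^sup>T *\<^sub>v (V *\<^sub>v x) = V\<^sup>T * V *\<^sub>v x"
      using V by (intro assoc_mult_mat_vec[symmetric]) auto
    then show "\<exists>y\<in>carrier_vec (dim_row V). V\<^sup>T *\<^sub>v y = V\<^sup>T * V *\<^sub>v x"
      using V x by (intro bexI[of _ "V *\<^sub>v x"]) auto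
  next
    fix x :: "real vec" assume x: "x \<in> carrier_vec (dim_row V)"
    then have "V\<^sup>T * V *\<^sub>v (R *\<^sub>v x) = V\<^sup>T *\<^sub>v x"
      using V R ZR assoc_mult_mat_vec[OF Z R, of x] by simp
    then show "\<exists>y\<in>carrier_vec (dim_col V). V\<^sup>T * V *\<^sub>v y = V\<^sup>T *\<^sub>v x"
      using V R x by (intro bexI[of _ "R *\<^sub>v x"]) auto
  qed
  then have "rank (V\<^sup>T * V) = rank (V\<^sup>T)"
    by (simp add: rank_def col_space_def)
  also have "rank (V\<^sup>T) = d"
  proof -
    have inj: "y = 0\<^sub>v d" if y: "y \<in> carrier_vec d" "V\<^sup>T *\<^sub>v y = 0\<^sub>v n" for y
    proof -
      have "y = (R\<^sup>T * V\<^sup>T) *\<^sub>v y" using RtVt y by simp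
      also have "\<dots> = R\<^sup>T *\<^sub>v (V\<^sup>T *\<^sub>v y)"
        using R Vt y by (intro assoc_mult_mat_vec) auto
      also have "\<dots> = 0\<^sub>v d" using R y by (intro eq_vecI) auto
      finally show ?thesis .
    qed
    have col: "R\<^sup>T *\<^sub>v col (V\<^sup>T) j = unit_vec d j" if "j < d" for j
    proof -
      have "R\<^sup>T *\<^sub>v col (V\<^sup>T) j = col (R\<^sup>T * V\<^sup>T) j"
        using R by (intro col_mult2[symmetric, OF _ Vt that]) auto
      also have "\<dots> = unit_vec d j" unfolding RtVt using that by simp
      finally show ?thesis .
    qed
    have dist: "distinct (cols (V\<^sup>T))"
    proof (rule distinct_conv_nth[THEN iffD2], intro allI impI)
      fix i j assume "i < length (cols (V\<^sup>T))" "j < length (cols (V\<^sup>T))" "i \<noteq> j"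
      then have ij: "i < d" "j < d" "i \<noteq> j" using Vt V by auto
      have "unit_vec d i \<noteq> (unit_vec d j :: real vec)" using ij by simp
      then have "col (V\<^sup>T) i \<noteq> col (V\<^sup>T) j" using ij col by metis
      then show "cols (V\<^sup>T) ! i \<noteq> cols (V\<^sup>T) ! j" using ij V by simp
    qed
    have "lin_indpt (set (cols (V\<^sup>T)))"
      using lin_depE[OF Vt _ dist] inj by blast
    then show ?thesis using lin_indpt_full_rank[OF Vt dist] by simp
  qed
  finally show ?thesis .
qed

lemma quadratic_form_sum:
  fixes A :: "real mat"
  assumes "A \<in> carrier_mat n n" and "x \<in> carrier_vec n"
  shows "x \<bullet> (A *\<^sub>v x) = (\<Sum>i<n. \<Sum>j<n. A $$ (i, j) * (x $ i * x $ j))"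
  using assms
  by (simp add: scalar_prod_def atLeast0LessThan sum_distrib_left mult.commute mult.left_commute)

text \<open>Weak duality rests on this case of the nonnegativity of the trace pairing: if one factor is a Gram
  matrix, the pairing is the sum of the quadratic form of the other over the rows of \<open>V\<close>.\<close>

lemma gram_psd_pairing_nonneg:
  fixes V X :: "real mat"
  assumes V: "V \<in> carrier_mat d n" and X: "psd n X"
  shows "0 \<le> (\<Sum>i<n. \<Sum>j<n. (V\<^sup>T * V) $$ (i, j) * X $$ (i, j))"
proof -
  have Xc: "X \<in> carrier_mat n n" using X by (simp add: psd_def)
  have "(\<Sum>i<n. \<Sum>j<n. (V\<^sup>T * V) $$ (i, j) * X $$ (i, j))
      = (\<Sum>i<n. \<Sum>j<n. \<Sum>r<d. X $$ (i, j) * (V $$ (r, i) * V $$ (r, j)))"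
    using V by (intro sum.cong refl)
      (simp add: scalar_prod_def atLeast0LessThan sum_distrib_left mult.commute mult.left_commute)
  also have "\<dots> = (\<Sum>i<n. \<Sum>r<d. \<Sum>j<n. X $$ (i, j) * (V $$ (r, i) * V $$ (r, j)))"
    by (intro sum.cong refl sum.swap)
  also have "\<dots> = (\<Sum>r<d. \<Sum>i<n. \<Sum>j<n. X $$ (i, j) * (V $$ (r, i) * V $$ (r, j)))"
    by (rule sum.swap)
  also have "\<dots> = (\<Sum>r<d. row V r \<bullet> (X *\<^sub>v row V r))"
    using V Xc by (intro sum.cong refl) (simp add: quadratic_form_sum)
  also have "\<dots> \<ge> 0"
    using X V by (intro sum_nonneg) (auto simp: psd_def)
  finally show ?thesis .
qed

lemma psd_quadratic_form_zero:
  assumes A: "psd n A" and v: "v \<in> carrier_vec n" and zero: "v \<bullet> (A *\<^sub>v v) = 0"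
  shows "A *\<^sub>v v = 0\<^sub>v n"
proof -
  have Ac: "A \<in> carrier_mat n n" and At: "A\<^sup>T = A"
    and nn: "\<And>x. x \<in> carrier_vec n \<Longrightarrow> x \<bullet> (A *\<^sub>v x) \<ge> 0" using A by (auto simp: psd_def)
  define w where "w = A *\<^sub>v v"
  have w: "w \<in> carrier_vec n" using Ac v by (simp add: w_def)
  define a b where "a = w \<bullet> w" and "b = w \<bullet> (A *\<^sub>v w)"
  have vw: "v \<bullet> (A *\<^sub>v w) = a"
    using transpose_vec_mult_scalar[OF Ac w v] At comm_scalar_prod[OF w w] 
    unfolding a_def w_def
    by (metis w_def)
  have wv: "w \<bullet> (A *\<^sub>v v) = a" by (simp add: a_def w_def)
  \<comment> \<open>The form is nonnegative along the line through \<open>v\<close> in direction \<open>w\<close>, so its linear term vanishes.\<close>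
  have quad: "0 \<le> 2 * e * a + e\<^sup>2 * b" for e :: real
  proof -
    have "0 \<le> (v + e \<cdot>\<^sub>v w) \<bullet> (A *\<^sub>v (v + e \<cdot>\<^sub>v w))" using v w by (intro nn) auto
    also have "A *\<^sub>v (v + e \<cdot>\<^sub>v w) = A *\<^sub>v v + e \<cdot>\<^sub>v (A *\<^sub>v w)"
      using Ac v w by (simp add: mult_add_distrib_mat_vec mult_mat_vec)
    also have "(v + e \<cdot>\<^sub>v w) \<bullet> (A *\<^sub>v v + e \<cdot>\<^sub>v (A *\<^sub>v w)) = 2 * e * a + e\<^sup>2 * b"
      using Ac v w zero vw wv
      by (simp add: scalar_prod_add_distrib[of _ n] add_scalar_prod_distrib[of _ n] b_def
          power2_eq_square algebra_simps)
    finally show ?thesis .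
  qed
  have a0: "a \<ge> 0" by (simp add: a_def scalar_prod_def sum_nonneg)
  have b0: "b \<ge> 0" using nn w by (simp add: b_def)
  have "a = 0"
  proof (rule ccontr)
    assume "a \<noteq> 0"
    then have a: "a > 0" using a0 by simp
    have "0 \<le> 2 * (- (a / (b + 1))) * a + (- (a / (b + 1)))\<^sup>2 * b" by (rule quad)
    also have "\<dots> = - (a\<^sup>2 * (b + 2) / (b + 1)\<^sup>2)"
      using b0 by (simp add: power2_eq_square divide_simps) (simp add: algebra_simps)
    also have "\<dots> < 0" using a b0 by simp
    finally show False by simp
  qed
  then show ?thesis
    using scalar_prod_self_zero[OF w] by (simp add: a_def w_def)
qed

section \<open>Exactness from a dual slack\<close>

lemma dual_slack_carrier:
  "W \<in> carrier_mat n n \<Longrightarrow> dual_slack n W s \<in> carrier_mat n n"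
  unfolding dual_slack_def laplacian_def mat_diag_def by (intro carrier_matI) auto

lemma dual_slack_index:
  assumes "W \<in> carrier_mat n n" and "i < n" and "j < n"
  shows "dual_slack n W s $$ (i, j)
    = (if i = j then s $ i - (\<Sum>l<n. W $$ (i, l)) / 4 else 0) + W $$ (i, j) / 4"
  using assms by (simp add: dual_slack_def laplacian_def mat_diag_def field_simps)

text \<open>Since the diagonal of \<open>X\<close> is fixed, the dual slack measures exactly the gap between the
  two objective values.\<close>

lemma sdp_value_dual_slack:
  assumes W: "W \<in> carrier_mat n n" and W0: "\<forall>i<n. W $$ (i, i) = 0" and X1: "\<forall>i<n. X $$ (i, i) = 1"
  shows "sdp_value n W X = (\<Sum>i<n. s $ i) - (\<Sum>i<n. \<Sum>j<n. dual_slack n W s $$ (i, j) * X $$ (i, j))"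
proof -
  define \<delta> where "\<delta> i = (\<Sum>l<n. W $$ (i, l))" for i
  define q where "q i = (\<Sum>j<n. W $$ (i, j) * X $$ (i, j))" for i
  have "(\<Sum>j\<in>{..<n} - {i}. W $$ (i, j) * (1 - X $$ (i, j))) = \<delta> i - q i" if "i < n" for i
    using that W0 by (simp add: sum_diff1 \<delta>_def q_def sum_subtractf right_diff_distrib)
  then have val: "sdp_value n W X = (\<Sum>i<n. \<delta> i / 4 - q i / 4)"
    by (simp add: sdp_value_def sum_subtractf sum_divide_distrib diff_divide_distrib)
  have "(\<Sum>j<n. dual_slack n W s $$ (i, j) * X $$ (i, j)) = s $ i - \<delta> i / 4 + q i / 4" if i: "i < n" for i
  proof -
    have "(\<Sum>j<n. dual_slack n W s $$ (i, j) * X $$ (i, j))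
        = (\<Sum>j<n. (if j = i then s $ i - \<delta> i / 4 else 0) + W $$ (i, j) * X $$ (i, j) / 4)"
      using i X1 by (intro sum.cong refl) (auto simp: dual_slack_index[OF W] \<delta>_def distrib_right)
    also have "\<dots> = s $ i - \<delta> i / 4 + q i / 4"
      using i by (simp add: sum.distrib q_def sum_divide_distrib)
    finally show ?thesis .
  qed
  then have "(\<Sum>i<n. \<Sum>j<n. dual_slack n W s $$ (i, j) * X $$ (i, j))
      = (\<Sum>i<n. s $ i) - (\<Sum>i<n. \<delta> i / 4 - q i / 4)"
    by (simp add: sum.distrib sum_subtractf)
  with val show ?thesis by simp
qed

definition rank_one :: "nat \<Rightarrow> real vec \<Rightarrow> real mat" where
  "rank_one n x = mat n n (\<lambda>(i, j). x $ i * x $ j)"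

lemma cut_value_rank_one: "cut_value n W x = sdp_value n W (rank_one n x)"
  by (simp add: cut_value_def sdp_value_def rank_one_def)

lemma rank_one_sdp_feasible:
  assumes x: "x \<in> sign_vecs n"
  shows "rank_one n x \<in> sdp_feasible n"
proof -
  have "0 \<le> v \<bullet> (rank_one n x *\<^sub>v v)" if v: "v \<in> carrier_vec n" for v
  proof -
    have "v \<bullet> (rank_one n x *\<^sub>v v) = (\<Sum>i<n. \<Sum>j<n. (x $ i * v $ i) * (x $ j * v $ j))"
      using v by (subst quadratic_form_sum)
        (auto simp: rank_one_def mult.commute mult.left_commute intro!: sum.cong)
    also have "\<dots> = (\<Sum>i<n. x $ i * v $ i)\<^sup>2"
      by (simp add: power2_eq_square sum_product)
    finally show ?thesis by simp
  qed
  moreover have "(rank_one n x)\<^sup>T = rank_one n x"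
    by (auto simp: rank_one_def intro!: eq_matI)
  moreover have "x $ i * x $ i = 1" if "i < n" for i
    using x that by (auto simp: sign_vecs_def)
  ultimately show ?thesis
    by (auto simp: sdp_feasible_def psd_def rank_one_def)
qed

lemma cut_value_dual_slack:
  assumes W: "W \<in> carrier_mat n n" and W0: "\<forall>i<n. W $$ (i, i) = 0" and x: "x \<in> sign_vecs n"
  shows "cut_value n W x = (\<Sum>i<n. s $ i) - x \<bullet> (dual_slack n W s *\<^sub>v x)"
proof -
  have "\<forall>i<n. rank_one n x $$ (i, i) = 1"
    using rank_one_sdp_feasible[OF x] by (simp add: sdp_feasible_def)
  then have "cut_value n W x
      = (\<Sum>i<n. s $ i) - (\<Sum>i<n. \<Sum>j<n. dual_slack n W s $$ (i, j) * rank_one n x $$ (i, j))"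
    using W W0 by (simp add: cut_value_rank_one sdp_value_dual_slack)
  moreover have "x \<in> carrier_vec n" using x by (simp add: sign_vecs_def)
  moreover have "dual_slack n W s \<in> carrier_mat n n"
    using W by (rule dual_slack_carrier)
  ultimately show ?thesis
    by (simp add: quadratic_form_sum rank_one_def)
qed

lemma finite_sign_vecs: "finite (sign_vecs n)"
proof (rule finite_subset)
  show "sign_vecs n \<subseteq> vec n ` ({..<n} \<rightarrow>\<^sub>E {-1, 1})"
  proof
    fix x assume x: "x \<in> sign_vecs n"
    then have "x = vec n (restrict (($) x) {..<n})"
      by (intro eq_vecI) (auto simp: sign_vecs_def)
    moreover have "restrict (($) x) {..<n} \<in> {..<n} \<rightarrow>\<^sub>E {-1, 1}"
      using x by (auto simp: sign_vecs_def PiE_iff)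
    ultimately show "x \<in> vec n ` ({..<n} \<rightarrow>\<^sub>E {-1, 1})" by blast
  qed
qed (auto intro: finite_PiE)

text \<open>A sign vector in the kernel of a dual slack certifies everything at once.  By weak duality the dual
  value of \<open>s\<close> bounds the SDP value, and the cut \<open>x0\<close> attains it, so the instance is exact and the optimal cuts
  are the sign vectors in the kernel.  If \<open>t\<close> is another optimal dual solution, its slack also kills \<open>x0\<close>;
  as no coordinate of \<open>x0\<close> vanishes and the two slacks differ only on the diagonal, \<open>t = s\<close>.\<close>

proposition exact_from_gram_slack:
  assumes inst: "maxcut_instance n W" and s: "s \<in> carrier_vec n"
    and V: "V \<in> carrier_mat d n" and Z: "dual_slack n W s = V\<^sup>T * V"
    and x0: "x0 \<in> sign_vecs n" "x0 \<in> mat_kernel (dual_slack n W s)"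
  shows "exact_instance n W"
    and "is_optimal_dual_slack n W (dual_slack n W s)"
    and "optimal_cuts n W = sign_vecs n \<inter> mat_kernel (dual_slack n W s)"
proof -
  have W: "W \<in> carrier_mat n n" and W0: "\<forall>i<n. W $$ (i, i) = 0"
    using inst by (auto simp: maxcut_instance_def)
  have slack: "dual_slack n W t \<in> carrier_mat n n" for t
    using W by (rule dual_slack_carrier)
  have sign_carrier: "x \<in> carrier_vec n" if "x \<in> sign_vecs n" for x
    using that by (simp add: sign_vecs_def)
  define opt where "opt = (\<Sum>i<n. s $ i)"
  have psdZ: "psd n (dual_slack n W s)" using Z gram_psd[OF V] by simp
  have kernel_iff: "x \<in> mat_kernel (dual_slack n W s) \<longleftrightarrow> cut_value n W x = opt" if x: "x \<in> sign_vecs n" for x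
  proof -
    have "x \<in> mat_kernel (dual_slack n W s) \<longleftrightarrow> dual_slack n W s *\<^sub>v x = 0\<^sub>v n"
      using mat_kernel[OF slack] sign_carrier[OF x] by simp
    also have "\<dots> \<longleftrightarrow> x \<bullet> (dual_slack n W s *\<^sub>v x) = 0"
      using psd_quadratic_form_zero[OF psdZ sign_carrier[OF x]] sign_carrier[OF x]
        scalar_prod_right_zero[of x n] by metis
    also have "\<dots> \<longleftrightarrow> cut_value n W x = opt"
      using cut_value_dual_slack[OF W W0 x, of s] by (simp add: opt_def)
    finally show ?thesis .
  qed
  have cut_le: "cut_value n W x \<le> opt" if "x \<in> sign_vecs n" for x
    using cut_value_dual_slack[OF W W0 that, of s] psdZ sign_carrier[OF that]
    by (auto simp: opt_def psd_def)
  have cut0: "cut_value n W x0 = opt" using kernel_iff x0 by blast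
  have MC: "MC n W = opt"
    unfolding MC_def by (rule Max_eqI) (use cut_le cut0 x0 finite_sign_vecs in auto)
  have "sdp_value n W X \<le> opt" if "X \<in> sdp_feasible n" for X
    using that sdp_value_dual_slack[OF W W0, of X s] gram_psd_pairing_nonneg[OF V, of X]
    by (simp add: sdp_feasible_def opt_def Z)
  then have "SDP n W = opt"
    unfolding SDP_def using cut0 rank_one_sdp_feasible[OF x0(1)]
    by (intro cSup_eq_maximum) (auto simp: cut_value_rank_one intro: rev_image_eqI)
  with MC inst show "exact_instance n W" by (simp add: exact_instance_def)
  show "optimal_cuts n W = sign_vecs n \<inter> mat_kernel (dual_slack n W s)"
    using kernel_iff MC by (auto simp: optimal_cuts_def)
  have dual_gap: "opt = (\<Sum>i<n. t $ i) - x0 \<bullet> (dual_slack n W t *\<^sub>v x0)" for t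
    using cut0 cut_value_dual_slack[OF W W0 x0(1), of t] by simp
  have dual_ge: "opt \<le> (\<Sum>i<n. t $ i)" if "t \<in> dual_feasible n W" for t
    using that dual_gap[of t] sign_carrier[OF x0(1)] by (auto simp: dual_feasible_def psd_def)
  have sopt: "dual_optimal n W s"
    using s psdZ dual_ge by (auto simp: dual_optimal_def dual_feasible_def opt_def)
  moreover have "t = s" if t: "dual_optimal n W t" for t
  proof (rule eq_vecI)
    have feas: "t \<in> carrier_vec n" "psd n (dual_slack n W t)"
      using t by (auto simp: dual_optimal_def dual_feasible_def)
    have "(\<Sum>i<n. t $ i) = opt"
      using t sopt dual_ge by (auto simp: dual_optimal_def opt_def intro: order_antisym)
    then have "dual_slack n W t *\<^sub>v x0 = 0\<^sub>v n"
      using dual_gap[of t] psd_quadratic_form_zero[OF feas(2) sign_carrier[OF x0(1)]] by simp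
    moreover have "dual_slack n W s *\<^sub>v x0 = 0\<^sub>v n"
      using x0 mat_kernel[OF slack] by simp
    ultimately have eq: "(dual_slack n W t *\<^sub>v x0) $ i = (dual_slack n W s *\<^sub>v x0) $ i" for i by simp
    fix i assume "i < dim_vec s"
    then have i: "i < n" using s by simp
    \<comment> \<open>Row \<open>i\<close> of a slack depends on the dual solution only through the diagonal entry.\<close>
    have expand: "(dual_slack n W u *\<^sub>v x0) $ i
        = (u $ i - (\<Sum>l<n. W $$ (i, l)) / 4) * x0 $ i + (\<Sum>j<n. W $$ (i, j) / 4 * x0 $ j)" for u
    proof -
      have "(dual_slack n W u *\<^sub>v x0) $ i = (\<Sum>j<n. dual_slack n W u $$ (i, j) * x0 $ j)"
        using i sign_carrier[OF x0(1)] slack[of u]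
        by (simp add: scalar_prod_def atLeast0LessThan)
      also have "\<dots> = (\<Sum>j<n. (if j = i then (u $ i - (\<Sum>l<n. W $$ (i, l)) / 4) * x0 $ i else 0)
          + W $$ (i, j) / 4 * x0 $ j)"
        using i by (intro sum.cong refl) (auto simp: dual_slack_index[OF W] distrib_right)
      also have "\<dots> = (u $ i - (\<Sum>l<n. W $$ (i, l)) / 4) * x0 $ i + (\<Sum>j<n. W $$ (i, j) / 4 * x0 $ j)"
        using i by (simp add: sum.distrib)
      finally show ?thesis .
    qed
    have "x0 $ i \<noteq> 0" using x0 i by (auto simp: sign_vecs_def)
    then show "t $ i = s $ i" using eq[of i] by (simp add: expand)
  qed (use t s in \<open>auto simp: dual_optimal_def dual_feasible_def\<close>)
  ultimately show "is_optimal_dual_slack n W (dual_slack n W s)"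
    unfolding is_optimal_dual_slack_def by blast
qed

text \<open>The weights whose dual slack can be a prescribed matrix: a slack agrees with \<open>W / 4\<close> off the
  diagonal.\<close>

definition slack_weights :: "nat \<Rightarrow> real mat \<Rightarrow> real mat" where
  "slack_weights n Z = mat n n (\<lambda>(i, j). if i = j then 0 else 4 * Z $$ (i, j))"

text \<open>Every square matrix is thus a dual slack; the diagonal is matched when the dual variables are the
  row sums of \<open>Z\<close>.\<close>

lemma dual_slack_slack_weights:
  assumes Z: "Z \<in> carrier_mat n n"
  shows "dual_slack n (slack_weights n Z) (vec n (\<lambda>i. \<Sum>j<n. Z $$ (i, j))) = Z"
proof (rule eq_matI)
  have W: "slack_weights n Z \<in> carrier_mat n n" by (simp add: slack_weights_def)
  fix i j assume "i < dim_row Z" "j < dim_col Z"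
  then have ij: "i < n" "j < n" using Z by auto
  have "(\<Sum>l<n. slack_weights n Z $$ (i, l)) = (\<Sum>l<n. 4 * Z $$ (i, l) - (if l = i then 4 * Z $$ (i, i) else 0))"
    using ij by (intro sum.cong) (auto simp: slack_weights_def)
  also have "\<dots> = 4 * (\<Sum>l<n. Z $$ (i, l)) - 4 * Z $$ (i, i)"
    using ij by (simp add: sum_subtractf sum_distrib_left)
  finally show "dual_slack n (slack_weights n Z) (vec n (\<lambda>i. \<Sum>j<n. Z $$ (i, j))) $$ (i, j) = Z $$ (i, j)"
    using ij by (subst dual_slack_index[OF W]) (auto simp: slack_weights_def field_simps)
qed (use Z in \<open>auto simp: dual_slack_def laplacian_def slack_weights_def mat_diag_def\<close>)

section \<open>Blow-ups and relations with sign coefficients\<close>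

text \<open>The columns are repeated cyclically, so that column \<open>j\<close> is a copy of column \<open>j mod k\<close>, and
  \<open>j div k\<close> numbers the copies.\<close>

definition blow_up :: "nat \<Rightarrow> real mat \<Rightarrow> real mat" where
  "blow_up c V = mat (dim_row V) (c * dim_col V) (\<lambda>(r, j). V $$ (r, j mod dim_col V))"

text \<open>A relation among the columns of a blow-up only depends on the total coefficient that it gives
  to each class of equal columns.\<close>

definition class_sums :: "nat \<Rightarrow> nat \<Rightarrow> real vec \<Rightarrow> real vec" where
  "class_sums c k x = vec k (\<lambda>a. \<Sum>b<c. x $ (b * k + a))"

lemma class_sums_carrier [simp]: "class_sums c k x \<in> carrier_vec k"
  by (simp add: class_sums_def)

lemma index_bound: "b * k + a < c * k" if "b < c" "a < k" for a b c k :: nat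
proof -
  have "b * k + a < (b + 1) * k" using that by simp
  also have "\<dots> \<le> c * k" using that by (intro mult_right_mono) auto
  finally show ?thesis .
qed

lemma sum_over_copies:
  fixes f :: "nat \<Rightarrow> 'a :: comm_monoid_add"
  shows "(\<Sum>j<c * k. f j) = (\<Sum>a<k. \<Sum>b<c. f (b * k + a))"
proof -
  have "(\<Sum>j<c * k. f j) = (\<Sum>b<c. sum f {b * k..<b * k + k})"
    by (rule sum.nat_group[symmetric])
  also have "\<dots> = (\<Sum>b<c. \<Sum>a<k. f (b * k + a))"
  proof (rule sum.cong[OF refl])
    fix b
    show "sum f {b * k..<b * k + k} = (\<Sum>a<k. f (b * k + a))"
      using sum.shift_bounds_nat_ivl[of f 0 "b * k" k]
      by (simp add: atLeast0LessThan add.commute)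
  qed
  also have "\<dots> = (\<Sum>a<k. \<Sum>b<c. f (b * k + a))" by (rule sum.swap)
  finally show ?thesis .
qed

lemma blow_up_mult:
  assumes V: "V \<in> carrier_mat d k" and x: "x \<in> carrier_vec (c * k)"
  shows "blow_up c V *\<^sub>v x = V *\<^sub>v class_sums c k x"
proof (rule eq_vecI)
  fix r assume "r < dim_vec (V *\<^sub>v class_sums c k x)"
  then have r: "r < d" using V by simp
  have "(blow_up c V *\<^sub>v x) $ r = (\<Sum>j<c * k. V $$ (r, j mod k) * x $ j)"
    using r V x by (simp add: blow_up_def scalar_prod_def atLeast0LessThan)
  also have "\<dots> = (\<Sum>a<k. \<Sum>b<c. V $$ (r, a) * x $ (b * k + a))"
    unfolding sum_over_copies by (intro sum.cong refl) simp
  also have "\<dots> = (V *\<^sub>v class_sums c k x) $ r"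
    using r V by (simp add: scalar_prod_def atLeast0LessThan class_sums_def sum_distrib_left)
  finally show "(blow_up c V *\<^sub>v x) $ r = (V *\<^sub>v class_sums c k x) $ r" .
qed (use V in \<open>simp add: blow_up_def\<close>)

lemma blow_up_carrier: "V \<in> carrier_mat d k \<Longrightarrow> blow_up c V \<in> carrier_mat d (c * k)"
  by (auto simp: blow_up_def)

lemma mat_kernel_blow_up:
  assumes V: "V \<in> carrier_mat d k"
  shows "mat_kernel (blow_up c V) = {x \<in> carrier_vec (c * k). class_sums c k x \<in> mat_kernel V}"
  using mat_kernel[OF blow_up_carrier[OF V]] mat_kernel[OF V] blow_up_mult[OF V]
  by auto

text \<open>The first \<open>m + u a\<close> of the \<open>2 * m\<close> copies of column \<open>a\<close> are positive and the others
  negative, so that the signs in that class add up to \<open>2 * u a\<close>.\<close>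

definition threshold_signs :: "nat \<Rightarrow> nat \<Rightarrow> (nat \<Rightarrow> int) \<Rightarrow> real vec" where
  "threshold_signs m k u =
    vec (2 * m * k) (\<lambda>j. if int (j div k) < int m + u (j mod k) then 1 else -1)"

lemma threshold_signs_sign_vec: "threshold_signs m k u \<in> sign_vecs (2 * m * k)"
  by (auto simp: threshold_signs_def sign_vecs_def)

lemma class_sums_threshold_signs:
  assumes u: "\<And>a. a < k \<Longrightarrow> \<bar>u a\<bar> \<le> int m"
  shows "class_sums (2 * m) k (threshold_signs m k u) = vec k (\<lambda>a. 2 * of_int (u a))"
proof (rule eq_vecI)
  fix a assume "a < dim_vec (vec k (\<lambda>a. 2 * of_int (u a) :: real))"
  then have a: "a < k" by simp
  define t where "t = nat (int m + u a)"
  have t: "int t = int m + u a" "t \<le> 2 * m" using u[OF a] by (auto simp: t_def)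
  have "(\<Sum>b<2 * m. threshold_signs m k u $ (b * k + a))
      = (\<Sum>b<2 * m. if b < t then 1 else -1 :: real)"
    using a t(1) by (intro sum.cong refl) (auto simp: threshold_signs_def index_bound)
  also have "\<dots> = (\<Sum>b<t. if b < t then 1 else -1) + (\<Sum>b\<in>{t..<2 * m}. if b < t then 1 else -1)"
  proof -
    have "{..<2 * m} = {..<t} \<union> {t..<2 * m}" using t(2) by auto
    moreover have "{..<t} \<inter> {t..<2 * m} = {}" by auto
    ultimately show ?thesis by (simp only: sum.union_disjoint finite_lessThan finite_atLeastLessThan)
  qed
  also have "\<dots> = real t - real (2 * m - t)" by simp
  also have "\<dots> = 2 * of_int (u a)"
  proof -
    have "real t = real m + of_int (u a)" using t(1) by linarith
    then show ?thesis using t(2) by (simp add: of_nat_diff)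
  qed
  finally show "class_sums (2 * m) k (threshold_signs m k u) $ a
      = vec k (\<lambda>a. 2 * of_int (u a) :: real) $ a"
    using a by (simp add: class_sums_def)
qed (simp add: class_sums_def)

lemma threshold_signs_in_kernel:
  assumes V: "V \<in> carrier_mat d k" and u: "vec k (\<lambda>a. of_int (u a)) \<in> mat_kernel V"
    and bound: "\<And>a. a < k \<Longrightarrow> \<bar>u a\<bar> \<le> int m"
  shows "threshold_signs m k u \<in> mat_kernel (blow_up (2 * m) V)"
proof -
  have "class_sums (2 * m) k (threshold_signs m k u) = 2 \<cdot>\<^sub>v vec k (\<lambda>a. of_int (u a))"
    by (subst class_sums_threshold_signs[OF bound]) auto
  moreover have "2 \<cdot>\<^sub>v vec k (\<lambda>a. of_int (u a)) \<in> mat_kernel V"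
    using u by (rule mat_kernel_smult[OF V])
  ultimately show ?thesis
    by (simp add: mat_kernel_blow_up[OF V] threshold_signs_def)
qed

text \<open>A sign vector has no zero entry, which is too rigid for most integer relations.  With \<open>2 * m\<close> copies of
  each column there is enough room: every integer relation bounded by \<open>m\<close>, doubled, is the vector of class
  sums of a sign vector.  What these miss are the differences of two copies of the same column, and such a difference
  is half the difference of two balanced sign vectors that disagree in just these two positions.  Modulo these
  differences, any vector is supported on the first copies, where it is a relation of the original matrix.\<close>

proposition blow_up_kernel_spanned_by_signs:
  assumes V: "V \<in> carrier_mat d k" and m: "m > 0"
    and UV: "\<And>u. u \<in> U \<Longrightarrow> vec k (\<lambda>a. of_int (u a)) \<in> mat_kernel V"
    and Um: "\<And>u a. u \<in> U \<Longrightarrow> a < k \<Longrightarrow> \<bar>u a\<bar> \<le> int m"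
    and span: "mat_kernel V \<subseteq> vec_span k ((\<lambda>u. vec k (\<lambda>a. of_int (u a))) ` U)"
  defines "n \<equiv> 2 * m * k"
  shows "mat_kernel (blow_up (2 * m) V) = vec_span n (sign_vecs n \<inter> mat_kernel (blow_up (2 * m) V))"
proof -
  define B where "B = blow_up (2 * m) V"
  define S where "S = sign_vecs n \<inter> mat_kernel B"
  define sgn0 where "sgn0 = threshold_signs m k (\<lambda>_. 0)"
  define lift where "lift y = vec n (\<lambda>j. if j < k then y $ j else 0)" for y :: "real vec"
  define e where "e i = (unit_vec n i :: real vec)" for i
  have B: "B \<in> carrier_mat d n" using V by (simp add: B_def n_def blow_up_carrier)
  have kerB: "x \<in> mat_kernel B \<longleftrightarrow> x \<in> carrier_vec n \<and> V *\<^sub>v class_sums (2 * m) k x = 0\<^sub>v d" for x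
    using mat_kernel_blow_up[OF V, of "2 * m"] mat_kernel[OF V] by (auto simp: B_def n_def)
  have kerV: "y \<in> mat_kernel V \<longleftrightarrow> y \<in> carrier_vec k \<and> V *\<^sub>v y = 0\<^sub>v d" for y
    using mat_kernel[OF V] by simp
  interpret K: vec_space "TYPE(real)" k .
  interpret N: vec_space "TYPE(real)" n .
  have S: "S \<subseteq> carrier_vec n" by (auto simp: S_def sign_vecs_def)
  have span_carrier: "x \<in> carrier_vec n" if "x \<in> N.span S" for x
    using that N.span_is_subset2[OF S] by auto
  have span_add: "x + y \<in> N.span S" if "x \<in> N.span S" "y \<in> N.span S" for x y
    using that N.span_add1[OF S] by simp
  have span_smult: "r \<cdot>\<^sub>v x \<in> N.span S" if "x \<in> N.span S" for x r
    using that N.smult_in_span[OF S] by simp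
  have span_minus: "x - y \<in> N.span S" if "x \<in> N.span S" "y \<in> N.span S" for x y
  proof -
    have "x - y = x + (-1) \<cdot>\<^sub>v y" using that span_carrier by (intro eq_vecI) auto
    then show ?thesis using that span_add span_smult by metis
  qed
  have e_carrier [simp]: "e i \<in> carrier_vec n" for i by (simp add: e_def)
  have sgn0: "sgn0 \<in> carrier_vec n" by (simp add: sgn0_def n_def threshold_signs_def)
  have sgn0_kernel: "sgn0 \<in> mat_kernel B"
    unfolding sgn0_def B_def
  proof (rule threshold_signs_in_kernel[OF V])
    show "vec k (\<lambda>a. of_int 0) \<in> mat_kernel V"
      using V by (intro mat_kernelI[OF V]) (auto intro!: eq_vecI simp: scalar_prod_def)
  qed simp
  then have sgn0_S: "sgn0 \<in> S"
    using threshold_signs_sign_vec by (simp add: S_def sgn0_def n_def)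
  have zero_span: "0\<^sub>v n \<in> N.span S"
  proof -
    have "sgn0 - sgn0 = 0\<^sub>v n" using sgn0 by (intro eq_vecI) auto
    then show ?thesis using span_minus[of sgn0 sgn0] N.in_own_span[OF S] sgn0_S by auto
  qed
  \<comment> \<open>The balanced vector \<open>sgn0\<close> is \<open>1\<close> at \<open>i\<close> and \<open>-1\<close> at \<open>j\<close>; flipping both
    entries moves two equal columns against each other.\<close>
  have swap: "e i - e j \<in> N.span S"
    if ij: "i < n" "j < n" "i mod k = j mod k" "i div k < m" "m \<le> j div k" for i j
  proof -
    define x where "x = sgn0 - 2 \<cdot>\<^sub>v (e i - e j)"
    have neq: "i \<noteq> j" using ij by auto
    have x: "x \<in> sign_vecs n"
      using ij neq by (auto simp: sign_vecs_def x_def sgn0_def threshold_signs_def n_def e_def)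
    then have xc: "x \<in> carrier_vec n" by (simp add: sign_vecs_def)
    have "B *\<^sub>v x = 0\<^sub>v d"
    proof (rule eq_vecI)
      fix r assume "r < dim_vec (0\<^sub>v d :: real vec)"
      then have r: "r < d" by simp
      have row: "row B r \<in> carrier_vec n" using B r by auto
      have "row B r \<bullet> sgn0 = (B *\<^sub>v sgn0) $ r" using B r by simp
      also have "\<dots> = 0" using sgn0_kernel r mat_kernel[OF B] by simp
      finally have "row B r \<bullet> sgn0 = 0" .
      moreover have "row B r \<bullet> e i = row B r \<bullet> e j"
        using ij r B V by (simp add: e_def B_def blow_up_def n_def)
      moreover have "row B r \<bullet> x = row B r \<bullet> sgn0 - 2 * (row B r \<bullet> e i - row B r \<bullet> e j)"
        unfolding x_def using row sgn0
        by (subst scalar_prod_minus_distrib[of _ n])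
          (auto simp: scalar_prod_minus_distrib[of _ n])
      ultimately show "(B *\<^sub>v x) $ r = 0\<^sub>v d $ r" using B r by simp
    qed (use B in simp)
    then have "x \<in> S" using x xc mat_kernel[OF B] by (simp add: S_def)
    then have "(1/2) \<cdot>\<^sub>v (sgn0 - x) \<in> N.span S"
      using N.in_own_span[OF S] sgn0_S by (intro span_smult span_minus) auto
    moreover have "(1/2) \<cdot>\<^sub>v (sgn0 - x) = e i - e j"
      using sgn0 by (intro eq_vecI) (auto simp: x_def e_def)
    ultimately show ?thesis by simp
  qed
  have diff: "e i - e (i mod k) \<in> N.span S" if i: "i < n" for i
  proof -
    have k: "k > 0" using i by (cases k) (auto simp: n_def)
    have km: "k \<le> m * k" "m * k < n" using m k by (auto simp: n_def)
    have "i mod k < k" using k by simp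
    then have imod: "i mod k < n" "i mod k div k < m"
      using m km by (linarith, simp)
    \<comment> \<open>A copy in the negative half: two copies in the same half are compared through it.\<close>
    define l where "l = m * k + i mod k"
    have l: "l < n" "l mod k = i mod k" "l div k = m"
      using k m index_bound[of m "2 * m" "i mod k" k] by (auto simp: l_def n_def)
    show ?thesis
    proof (cases "i div k < m")
      case True
      have "e i - e (i mod k) = (e i - e l) - (e (i mod k) - e l)"
        by (intro eq_vecI) (auto simp: e_def)
      moreover have "e i - e l \<in> N.span S" using i l True by (intro swap) auto
      moreover have "e (i mod k) - e l \<in> N.span S" using imod l by (intro swap) auto
      ultimately show ?thesis using span_minus by metis
    next
      case False
      then have "e (i mod k) - e i \<in> N.span S" using imod i by (intro swap) auto
      moreover have "e i - e (i mod k) = (-1) \<cdot>\<^sub>v (e (i mod k) - e i)"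
        by (intro eq_vecI) (auto simp: e_def)
      ultimately show ?thesis using span_smult by metis
    qed
  qed
  \<comment> \<open>Moving every coefficient to the first copy of its column changes \<open>x\<close> within the span.\<close>
  have fold: "x - lift (class_sums (2 * m) k x) \<in> N.span S" if x: "x \<in> carrier_vec n" for x
  proof -
    have partial: "vec n (\<lambda>j. \<Sum>i<p. x $ i * (e i - e (i mod k)) $ j) \<in> N.span S" if "p \<le> n" for p
      using that
    proof (induction p)
      case 0
      have "vec n (\<lambda>j. \<Sum>i<0. x $ i * (e i - e (i mod k)) $ j) = 0\<^sub>v n"
        by (intro eq_vecI) auto
      then show ?case using zero_span by simp
    next
      case (Suc p)
      have eq: "vec n (\<lambda>j. \<Sum>i<Suc p. x $ i * (e i - e (i mod k)) $ j)
          = vec n (\<lambda>j. \<Sum>i<p. x $ i * (e i - e (i mod k)) $ j) + x $ p \<cdot>\<^sub>v (e p - e (p mod k))"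
        by (intro eq_vecI) (auto simp: e_def)
      show ?case unfolding eq
        using Suc by (intro span_add span_smult diff) auto
    qed
    have "x - lift (class_sums (2 * m) k x) = vec n (\<lambda>j. \<Sum>i<n. x $ i * (e i - e (i mod k)) $ j)"
    proof (rule eq_vecI)
      fix j assume "j < dim_vec (vec n (\<lambda>j. \<Sum>i<n. x $ i * (e i - e (i mod k)) $ j))"
      then have j: "j < n" by simp
      have "(\<Sum>i<n. x $ i * (e i - e (i mod k)) $ j)
          = (\<Sum>i<n. if j = i then x $ i else 0) - (\<Sum>i<n. if j = i mod k then x $ i else 0)"
        using j x unfolding sum_subtractf[symmetric]
        by (intro sum.cong refl) (auto simp: e_def unit_vec_def)
      also have "(\<Sum>i<n. if j = i then x $ i else 0) = x $ j" using j by simp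
      also have "(\<Sum>i<n. if j = i mod k then x $ i else 0)
          = (\<Sum>a<k. \<Sum>b<2 * m. if j = a then x $ (b * k + a) else 0)"
        unfolding n_def sum_over_copies by (intro sum.cong refl) auto
      also have "\<dots> = (\<Sum>a<k. if a = j then \<Sum>b<2 * m. x $ (b * k + a) else 0)"
        by (intro sum.cong refl) auto
      also have "\<dots> = lift (class_sums (2 * m) k x) $ j"
        using j by (simp add: lift_def class_sums_def)
      finally show "(x - lift (class_sums (2 * m) k x)) $ j
          = vec n (\<lambda>j. \<Sum>i<n. x $ i * (e i - e (i mod k)) $ j) $ j"
        using j x by (simp add: lift_def)
    qed (simp add: lift_def)
    then show ?thesis using partial[of n] by simp
  qed
  have lift_U: "lift (vec k (\<lambda>a. of_int (u a))) \<in> N.span S" if u: "u \<in> U" for u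
  proof -
    define x where "x = threshold_signs m k u"
    have x: "x \<in> sign_vecs n" "x \<in> carrier_vec n"
      using threshold_signs_sign_vec by (auto simp: x_def n_def sign_vecs_def)
    have sums: "class_sums (2 * m) k x = 2 \<cdot>\<^sub>v vec k (\<lambda>a. of_int (u a))"
      unfolding x_def by (subst class_sums_threshold_signs) (use Um u in auto)
    have "x \<in> S"
      using x threshold_signs_in_kernel[OF V UV[OF u] Um[OF u]] by (simp add: S_def B_def x_def)
    then have "x \<in> N.span S" using N.in_own_span[OF S] by blast
    then have "(1/2) \<cdot>\<^sub>v (x - (x - lift (class_sums (2 * m) k x))) \<in> N.span S"
      using fold[OF x(2)] by (rule span_smult[OF span_minus])
    moreover have "(1/2) \<cdot>\<^sub>v (x - (x - lift (class_sums (2 * m) k x))) = lift (vec k (\<lambda>a. of_int (u a)))"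
      using x by (intro eq_vecI) (auto simp: lift_def sums)
    ultimately show ?thesis by simp
  qed
  have lift_kernel: "lift y \<in> N.span S" if y: "y \<in> mat_kernel V" for y
  proof -
    define P where "P = {y \<in> carrier_vec k. lift y \<in> N.span S}"
    have "submodule class_ring P (module_vec TYPE(real) k)"
    proof (unfold_locales)
      fix v w assume vw: "v \<in> P" "w \<in> P"
      have "lift (v + w) = lift v + lift w"
        using vw by (intro eq_vecI) (auto simp: lift_def P_def)
      then show "v \<oplus>\<^bsub>module_vec TYPE(real) k\<^esub> w \<in> P"
        using vw span_add by (auto simp: P_def module_vec_simps)
    next
      have "lift (0\<^sub>v k) = 0\<^sub>v n" by (intro eq_vecI) (auto simp: lift_def)
      then show "\<zero>\<^bsub>module_vec TYPE(real) k\<^esub> \<in> P"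
        using zero_span by (simp add: P_def module_vec_simps)
    next
      fix r :: real and v assume v: "v \<in> P"
      have "lift (r \<cdot>\<^sub>v v) = r \<cdot>\<^sub>v lift v"
        using v by (intro eq_vecI) (auto simp: lift_def P_def)
      then show "r \<odot>\<^bsub>module_vec TYPE(real) k\<^esub> v \<in> P"
        using v span_smult by (auto simp: P_def module_vec_simps)
    qed (auto simp: P_def module_vec_simps)
    moreover have "(\<lambda>u. vec k (\<lambda>a. of_int (u a))) ` U \<subseteq> P"
      using lift_U by (auto simp: P_def)
    ultimately have "K.span ((\<lambda>u. vec k (\<lambda>a. of_int (u a))) ` U) \<subseteq> P"
      by (rule K.span_is_subset[rotated])
    then show ?thesis using y span by (auto simp: P_def)
  qed
  have "mat_kernel B \<subseteq> N.span S"
  proof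
    fix x assume x: "x \<in> mat_kernel B"
    then have xc: "x \<in> carrier_vec n" using kerB by simp
    have "class_sums (2 * m) k x \<in> mat_kernel V" using x by (simp add: kerB kerV)
    then have "(x - lift (class_sums (2 * m) k x)) + lift (class_sums (2 * m) k x) \<in> N.span S"
      using fold[OF xc] lift_kernel span_add by blast
    moreover have "(x - lift (class_sums (2 * m) k x)) + lift (class_sums (2 * m) k x) = x"
      using xc by (intro eq_vecI) (auto simp: lift_def)
    ultimately show "x \<in> N.span S" by simp
  qed
  moreover have "N.span S \<subseteq> mat_kernel B"
  proof (rule N.span_is_subset)
    show "S \<subseteq> mat_kernel B" by (simp add: S_def)
    show "submodule class_ring (mat_kernel B) (module_vec TYPE(real) n)"
    proof (unfold_locales)
      show "\<zero>\<^bsub>module_vec TYPE(real) n\<^esub> \<in> mat_kernel B"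
        using B by (auto simp: mat_kernel[OF B] module_vec_simps intro!: eq_vecI)
    qed (auto simp: mat_kernel[OF B] module_vec_simps mult_add_distrib_mat_vec[OF B] mult_mat_vec[OF B])
  qed
  ultimately show ?thesis by (auto simp: S_def B_def)
qed

section \<open>A pentagon of vectors with orthogonal neighbours\<close>

text \<open>Columns \<open>0\<close> to \<open>4\<close> are the vectors \<open>(1,0,0)\<close>, \<open>(0,1,0)\<close>, \<open>(1,0,1)\<close>,
  \<open>(1,1,-1)\<close>, \<open>(0,1,1)\<close> in the first three coordinates: cyclically consecutive ones are orthogonal, the
  other pairs have inner product \<open>1\<close>.  Column \<open>r + 2\<close>, for \<open>r \<ge> 3\<close>, is the sum of the unit
  vectors \<open>0\<close> and \<open>r\<close>; it raises the rank by one, and its inner product with each of the first five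
  columns is the same as that of column \<open>0\<close>.\<close>

definition pentagon_entry :: "nat \<Rightarrow> nat \<Rightarrow> real" where
  "pentagon_entry r j =
    (if r = 0 then of_bool (j \<noteq> 1 \<and> j \<noteq> 4)
     else if r = 1 then of_bool (j \<in> {1, 3, 4})
     else if r = 2 then of_bool (j = 2 \<or> j = 4) - of_bool (j = 3)
     else of_bool (j = r + 2))"

definition pentagon_mat :: "nat \<Rightarrow> real mat" where
  "pentagon_mat d = mat d (d + 2) (\<lambda>(r, j). pentagon_entry r j)"

text \<open>A basis of the linear relations among the columns; the entries are bounded by \<open>2\<close>, so four
  copies of each column will do.\<close>

definition pentagon_rel1 :: "nat \<Rightarrow> int" where
  "pentagon_rel1 j = of_bool (j = 0 \<or> j = 4) - of_bool (j = 1 \<or> j = 2)"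

definition pentagon_rel2 :: "nat \<Rightarrow> int" where
  "pentagon_rel2 j = 2 * of_bool (j = 0) + of_bool (j = 1) - of_bool (j = 2 \<or> j = 3)"

lemma sum_first_five:
  fixes f :: "nat \<Rightarrow> 'a :: comm_monoid_add"
  assumes "5 \<le> k" and "\<And>j. 5 \<le> j \<Longrightarrow> j < k \<Longrightarrow> f j = 0"
  shows "(\<Sum>j<k. f j) = f 0 + f 1 + f 2 + f 3 + f 4"
proof -
  have "(\<Sum>j<k. f j) = (\<Sum>j<5. f j)"
    using assms by (intro sum.mono_neutral_right) (auto simp: not_less)
  then show ?thesis by (simp add: eval_nat_numeral)
qed

text \<open>Only the first five columns matter, so this covers the blow-ups as well.\<close>

lemma pentagon_relations:
  assumes M: "M \<in> carrier_mat d n" and n: "5 \<le> n"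
    and entries: "\<And>r j. r < d \<Longrightarrow> j < 5 \<Longrightarrow> M $$ (r, j) = pentagon_entry r j"
    and u: "u \<in> {pentagon_rel1, pentagon_rel2}"
  shows "vec n (\<lambda>j. of_int (u j)) \<in> mat_kernel M"
proof -
  have "(M *\<^sub>v vec n (\<lambda>j. of_int (u j))) $ r = 0" if r: "r < d" for r
  proof -
    have "(M *\<^sub>v vec n (\<lambda>j. of_int (u j))) $ r = (\<Sum>j<n. M $$ (r, j) * of_int (u j))"
      using M r by (simp add: scalar_prod_def atLeast0LessThan)
    also have "\<dots> = M $$ (r, 0) * of_int (u 0) + M $$ (r, 1) * of_int (u 1) + M $$ (r, 2) * of_int (u 2)
        + M $$ (r, 3) * of_int (u 3) + M $$ (r, 4) * of_int (u 4)"
      using n u by (intro sum_first_five) (auto simp: pentagon_rel1_def pentagon_rel2_def)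
    also have "\<dots> = 0"
      using u r by (auto simp: entries pentagon_entry_def pentagon_rel1_def pentagon_rel2_def)
    finally show ?thesis .
  qed
  then show ?thesis using M by (intro mat_kernelI[OF M]) (auto intro: eq_vecI)
qed

lemma kernel_pentagon_mat:
  assumes d: "d \<ge> 3"
  shows "mat_kernel (pentagon_mat d)
      \<subseteq> vec_span (d + 2) ((\<lambda>u. vec (d + 2) (\<lambda>a. of_int (u a))) ` {pentagon_rel1, pentagon_rel2})"
    (is "_ \<subseteq> vec_span _ ?U")
proof
  interpret vec_space "TYPE(real)" "d + 2" .
  have M: "pentagon_mat d \<in> carrier_mat d (d + 2)" by (simp add: pentagon_mat_def)
  fix x assume "x \<in> mat_kernel (pentagon_mat d)"
  then have x: "x \<in> carrier_vec (d + 2)" and Mx: "pentagon_mat d *\<^sub>v x = 0\<^sub>v d"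
    using mat_kernel[OF M] by auto
  have eq: "(\<Sum>j<d + 2. pentagon_entry r j * x $ j) = 0" if r: "r < d" for r
  proof -
    have "(pentagon_mat d *\<^sub>v x) $ r = (\<Sum>j<d + 2. pentagon_entry r j * x $ j)"
      using r x by (simp add: pentagon_mat_def scalar_prod_def atLeast0LessThan)
    then show ?thesis using Mx r by simp
  qed
  have tail: "x $ j = 0" if j: "5 \<le> j" "j < d + 2" for j
  proof -
    have "0 = (\<Sum>l<d + 2. pentagon_entry (j - 2) l * x $ l)"
      using j by (intro eq[symmetric]) simp
    also have "\<dots> = (\<Sum>l<d + 2. if l = j then x $ l else 0)"
      using j by (intro sum.cong refl) (auto simp: pentagon_entry_def)
    also have "\<dots> = x $ j" using j by (subst sum.delta) auto
    finally show ?thesis by simp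
  qed
  have eq5: "pentagon_entry r 0 * x $ 0 + pentagon_entry r 1 * x $ 1 + pentagon_entry r 2 * x $ 2
      + pentagon_entry r 3 * x $ 3 + pentagon_entry r 4 * x $ 4 = 0" if "r < d" for r
  proof -
    have "(\<Sum>j<d + 2. pentagon_entry r j * x $ j)
        = pentagon_entry r 0 * x $ 0 + pentagon_entry r 1 * x $ 1 + pentagon_entry r 2 * x $ 2
          + pentagon_entry r 3 * x $ 3 + pentagon_entry r 4 * x $ 4"
      using d tail by (intro sum_first_five) auto
    then show ?thesis unfolding eq[OF that] by (rule sym)
  qed
  have x012: "x $ 0 + x $ 2 + x $ 3 = 0" "x $ 1 + x $ 3 + x $ 4 = 0" "x $ 2 - x $ 3 + x $ 4 = 0"
    using eq5[of 0] eq5[of 1] eq5[of 2] d by (simp_all add: pentagon_entry_def)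
  have U: "?U \<subseteq> carrier_vec (d + 2)" by auto
  have "x = x $ 4 \<cdot>\<^sub>v vec (d + 2) (\<lambda>a. of_int (pentagon_rel1 a))
      + (- (x $ 3)) \<cdot>\<^sub>v vec (d + 2) (\<lambda>a. of_int (pentagon_rel2 a))"
  proof (rule eq_vecI)
    fix j assume "j < dim_vec (x $ 4 \<cdot>\<^sub>v vec (d + 2) (\<lambda>a. of_int (pentagon_rel1 a))
        + (- (x $ 3)) \<cdot>\<^sub>v vec (d + 2) (\<lambda>a. of_int (pentagon_rel2 a)))"
    then have j: "j < d + 2" by simp
    consider "j = 0" | "j = 1" | "j = 2" | "j = 3" | "j = 4" | "5 \<le> j" by linarith
    then show "x $ j = (x $ 4 \<cdot>\<^sub>v vec (d + 2) (\<lambda>a. of_int (pentagon_rel1 a))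
        + (- (x $ 3)) \<cdot>\<^sub>v vec (d + 2) (\<lambda>a. of_int (pentagon_rel2 a))) $ j"
      using j x012 tail[of j] by cases (auto simp: pentagon_rel1_def pentagon_rel2_def)
  qed (use x in simp)
  moreover have "x $ 4 \<cdot>\<^sub>v vec (d + 2) (\<lambda>a. of_int (pentagon_rel1 a)) \<in> span ?U"
    "(- (x $ 3)) \<cdot>\<^sub>v vec (d + 2) (\<lambda>a. of_int (pentagon_rel2 a)) \<in> span ?U"
    by (intro smult_in_span[OF U] subsetD[OF in_own_span[OF U]] imageI; simp)+
  ultimately show "x \<in> span ?U" using span_add1[OF U] by metis
qed

lemma pentagon_row_zero:
  fixes b0 b1 b2 b3 b4 :: real
  assumes orth: "b0 * b1 = 0" "b2 * b3 = 0" "b4 * b0 = 0"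
    and rel: "b0 + b4 = b1 + b2" "2 * b0 + b1 = b2 + b3"
  shows "b0 = 0"
proof (rule ccontr)
  assume "b0 \<noteq> 0"
  then have "b1 = 0" "b4 = 0" using orth by auto
  then have "b2 = b0" "b3 = b0" using rel by auto
  then show False using orth(2) \<open>b0 \<noteq> 0\<close> by simp
qed

text \<open>Let \<open>b\<close> be a row of a nonnegative factor \<open>N\<close> of \<open>Z\<close>.  Nonnegativity turns a zero entry
  \<open>(i, j)\<close> of \<open>Z\<close> into \<open>b i * b j = 0\<close>, and \<open>b\<close> is orthogonal to the kernel of \<open>Z\<close>.
  Geometrically, on the pentagon \<open>b\<close> consists of the inner products with a fixed vector of three-space; it vanishes
  on at least three of the five columns because no three of them are pairwise non-orthogonal, and those three
  span the space.  Hence \<open>b\<close> vanishes on the pentagon, contradicting the positive diagonal of \<open>Z\<close>;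
  column \<open>0\<close> suffices for that.\<close>

lemma pentagon_not_completely_positive:
  assumes n: "5 \<le> n"
    and kernel: "vec n (\<lambda>j. of_int (pentagon_rel1 j)) \<in> mat_kernel Z" "vec n (\<lambda>j. of_int (pentagon_rel2 j)) \<in> mat_kernel Z"
    and zeros: "Z $$ (0, 1) = 0" "Z $$ (2, 3) = 0" "Z $$ (4, 0) = 0"
    and pos: "Z $$ (0, 0) \<noteq> 0"
  shows "\<not> completely_positive n Z"
proof
  assume "completely_positive n Z"
  then obtain K N where N: "N \<in> carrier_mat K n" and nonneg: "\<And>r j. r < K \<Longrightarrow> j < n \<Longrightarrow> N $$ (r, j) \<ge> 0"
    and Z: "Z = N\<^sup>T * N" by (auto simp: completely_positive_def)
  have Z_sum: "Z $$ (i, j) = (\<Sum>r<K. N $$ (r, i) * N $$ (r, j))" if "i < n" "j < n" for i j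
    using that N by (simp add: Z scalar_prod_def atLeast0LessThan)
  have orth: "N $$ (r, i) * N $$ (r, j) = 0" if "Z $$ (i, j) = 0" "r < K" "i < n" "j < n" for r i j
  proof -
    have "\<forall>r\<in>{..<K}. N $$ (r, i) * N $$ (r, j) = 0"
      using that Z_sum[of i j] nonneg by (subst sum_nonneg_eq_0_iff[symmetric]) auto
    then show ?thesis using that by blast
  qed
  have rel: "N $$ (r, 0) * of_int (u 0) + N $$ (r, 1) * of_int (u 1) + N $$ (r, 2) * of_int (u 2)
      + N $$ (r, 3) * of_int (u 3) + N $$ (r, 4) * of_int (u 4) = 0"
    if r: "r < K" and u: "u \<in> {pentagon_rel1, pentagon_rel2}" for r u
  proof -
    have "vec n (\<lambda>j. of_int (u j)) \<in> mat_kernel N"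
      using u kernel mat_kernel_gram[OF N] by (auto simp: Z)
    then have "(N *\<^sub>v vec n (\<lambda>j. of_int (u j))) $ r = 0"
      using r mat_kernel[OF N] by simp
    then have "(\<Sum>j<n. N $$ (r, j) * of_int (u j)) = 0"
      using N r by (simp add: scalar_prod_def atLeast0LessThan)
    then show ?thesis
      using n u by (subst (asm) sum_first_five) (auto simp: pentagon_rel1_def pentagon_rel2_def)
  qed
  have "N $$ (r, 0) = 0" if r: "r < K" for r
  proof (rule pentagon_row_zero)
    show "N $$ (r, 0) + N $$ (r, 4) = N $$ (r, 1) + N $$ (r, 2)"
      using rel[OF r, of pentagon_rel1] by (simp add: pentagon_rel1_def)
    show "2 * N $$ (r, 0) + N $$ (r, 1) = N $$ (r, 2) + N $$ (r, 3)"
      using rel[OF r, of pentagon_rel2] by (simp add: pentagon_rel2_def)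
  qed (use orth zeros r n in auto)
  then have "Z $$ (0, 0) = 0" using Z_sum[of 0 0] n by simp
  with pos show False by simp
qed

lemma connected_support_graph:
  assumes W: "W \<in> carrier_mat n n" "W\<^sup>T = W" and n: "n > 0"
    and hub: "\<And>i. i < n \<Longrightarrow> i \<noteq> 0 \<Longrightarrow>
      W $$ (i, 0) > 0 \<or> (\<exists>j<n. W $$ (i, j) > 0 \<and> W $$ (j, 0) > 0)"
  shows "connected (with_proj (support_graph n W))"
proof -
  define G where "G = with_proj (support_graph n W)"
  have arcs: "(i, j) \<in> arcs_ends G \<longleftrightarrow> i < n \<and> j < n \<and> W $$ (i, j) > 0" for i j
    by (simp add: G_def support_graph_def)
  have verts: "verts G = {..<n}" by (simp add: G_def support_graph_def)
  interpret wf_digraph G by unfold_locales (auto simp: G_def support_graph_def)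
  have Wsym: "W $$ (j, i) = W $$ (i, j)" if "i < n" "j < n" for i j
    using that W by (metis carrier_matD index_transpose_mat(1))
  have sym: "symmetric G"
    unfolding symmetric_def by (intro symI) (auto simp: arcs Wsym)
  have to_hub: "i \<rightarrow>\<^sup>*\<^bsub>G\<^esub> 0" if i: "i < n" for i
  proof (cases "i = 0")
    case True
    then show ?thesis using n verts by auto
  next
    case False
    then consider "i \<rightarrow>\<^bsub>G\<^esub> 0" | j where "i \<rightarrow>\<^bsub>G\<^esub> j" "j \<rightarrow>\<^bsub>G\<^esub> 0"
      using hub[OF i] i n arcs by blast
    then show ?thesis by cases (auto intro: reachable_trans)
  qed
  have "i \<rightarrow>\<^sup>*\<^bsub>G\<^esub> j" if "i < n" "j < n" for i j
    using to_hub symmetric_reachable[OF sym] that reachable_trans by blast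
  then have "strongly_connected (mk_symmetric G)"
    using n verts reachable_mk_symmetricI unfolding strongly_connected_def by auto
  then show ?thesis by (simp add: connected_def G_def)
qed

definition pentagon_gram :: "nat \<Rightarrow> nat \<Rightarrow> nat \<Rightarrow> real" where
  "pentagon_gram d i j = (\<Sum>r<d. pentagon_entry r i * pentagon_entry r j)"

text \<open>Coordinates beyond the third contribute a nonnegative amount, and nothing at all to inner products with
  the pentagon.\<close>

lemma pentagon_gram_head:
  assumes d: "d \<ge> 3"
  shows "pentagon_entry 0 i * pentagon_entry 0 j + pentagon_entry 1 i * pentagon_entry 1 j
      + pentagon_entry 2 i * pentagon_entry 2 j \<le> pentagon_gram d i j" (is "?h \<le> _")
    and "i < 5 \<Longrightarrow> pentagon_gram d i j = pentagon_entry 0 i * pentagon_entry 0 j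
      + pentagon_entry 1 i * pentagon_entry 1 j + pentagon_entry 2 i * pentagon_entry 2 j"
proof -
  have split: "pentagon_gram d i j = (\<Sum>r<3. pentagon_entry r i * pentagon_entry r j)
      + (\<Sum>r\<in>{3..<d}. pentagon_entry r i * pentagon_entry r j)"
    unfolding pentagon_gram_def by (metis atLeast0LessThan d sum.atLeastLessThan_concat zero_le)
  also have "(\<Sum>r<3. pentagon_entry r i * pentagon_entry r j) = ?h"
    by (simp add: eval_nat_numeral)
  finally have *: "pentagon_gram d i j = ?h + (\<Sum>r\<in>{3..<d}. pentagon_entry r i * pentagon_entry r j)" .
  have "(\<Sum>r\<in>{3..<d}. pentagon_entry r i * pentagon_entry r j) \<ge> 0"
    by (intro sum_nonneg) (auto simp: pentagon_entry_def)
  then show "?h \<le> pentagon_gram d i j" using * by simp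
  assume "i < 5"
  then have "(\<Sum>r\<in>{3..<d}. pentagon_entry r i * pentagon_entry r j) = 0"
    by (intro sum.neutral) (auto simp: pentagon_entry_def)
  then show "pentagon_gram d i j = ?h" using * by simp
qed

lemma pentagon_gram_nonneg:
  assumes "d \<ge> 3"
  shows "pentagon_gram d i j \<ge> 0"
proof -
  have "pentagon_entry 0 i * pentagon_entry 0 j + pentagon_entry 1 i * pentagon_entry 1 j
      + pentagon_entry 2 i * pentagon_entry 2 j \<ge> 0"
  proof (cases "i = 3 \<or> j = 3")
    case True
    then show ?thesis by (auto simp: pentagon_entry_def)
  next
    case False
    then show ?thesis
      by (intro add_nonneg_nonneg mult_nonneg_nonneg) (auto simp: pentagon_entry_def)
  qed
  then show ?thesis using pentagon_gram_head(1)[OF assms, of i j] by linarith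
qed

section \<open>Instances of every rank\<close>

theorem corollary3p14:
  fixes d :: nat
  assumes "d \<ge> 3"
  shows "\<exists>n W Z.
    exact_instance n W \<and>
    connected (with_proj (support_graph n W)) \<and>
    is_optimal_dual_slack n W Z \<and>
    vec_space.rank n Z = d \<and>
    \<not> completely_positive n Z \<and>
    (\<exists>S \<subseteq> optimal_cuts n W. mat_kernel Z = vec_span n S)"
proof -
  define k where "k = d + 2"
  define n where "n = 2 * 2 * k"
  define V where "V = pentagon_mat d"
  define B where "B = blow_up (2 * 2) V"
  define Z where "Z = B\<^sup>T * B"
  define W where "W = slack_weights n Z"
  define s where "s = vec n (\<lambda>i. \<Sum>j<n. Z $$ (i, j))"
  have k: "k \<ge> 5" and n: "n \<ge> 5" "k < n" using assms by (auto simp: k_def n_def)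
  have V: "V \<in> carrier_mat d k" by (simp add: V_def k_def pentagon_mat_def)
  have B: "B \<in> carrier_mat d n" using blow_up_carrier[OF V] by (simp add: B_def n_def)
  have B_entry: "B $$ (r, j) = pentagon_entry r (j mod k)" if "r < d" "j < n" for r j
    using that k by (simp add: B_def blow_up_def V_def pentagon_mat_def n_def k_def)
  have Z: "Z \<in> carrier_mat n n" using B by (simp add: Z_def)
  have Z_entry: "Z $$ (i, j) = pentagon_gram d (i mod k) (j mod k)" if "i < n" "j < n" for i j
    using that B by (simp add: Z_def scalar_prod_def atLeast0LessThan pentagon_gram_def B_entry)
  have W: "W \<in> carrier_mat n n" by (simp add: W_def slack_weights_def)
  have W_entry: "W $$ (i, j) = (if i = j then 0 else 4 * pentagon_gram d (i mod k) (j mod k))"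
    if "i < n" "j < n" for i j
    using that by (simp add: W_def slack_weights_def Z_entry)
  have slack: "dual_slack n W s = Z"
    using dual_slack_slack_weights[OF Z] by (simp add: W_def s_def)
  have kernel: "mat_kernel Z = mat_kernel B" by (simp add: Z_def mat_kernel_gram[OF B])
  have Wsym: "W\<^sup>T = W"
    using W by (intro eq_matI) (auto simp: W_entry pentagon_gram_def mult.commute)
  have gram_pos: "pentagon_gram d a 0 > 0" if "a \<noteq> 1" "a \<noteq> 4" for a
    using that pentagon_gram_head(1)[OF assms, of a 0] by (auto simp: pentagon_entry_def split: if_splits)
  have gram13: "pentagon_gram d 1 3 > 0" and gram42: "pentagon_gram d 4 2 > 0"
    using pentagon_gram_head(2)[OF assms] by (auto simp: pentagon_entry_def)
  \<comment> \<open>Copies of columns \<open>1\<close> and \<open>4\<close> are orthogonal to column \<open>0\<close>; they reach vertex \<open>0\<close>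
    through columns \<open>3\<close> and \<open>2\<close>.\<close>
  have hub: "W $$ (i, 0) > 0 \<or> (\<exists>j<n. W $$ (i, j) > 0 \<and> W $$ (j, 0) > 0)" if i: "i < n" "i \<noteq> 0" for i
  proof -
    consider "i mod k = 1" | "i mod k = 4" | "i mod k \<noteq> 1" "i mod k \<noteq> 4" by blast
    then show ?thesis
    proof cases
      case 1
      then have "i \<noteq> 3" using k by auto
      then have "W $$ (i, 3) > 0 \<and> W $$ (3, 0) > 0"
        using 1 i k n gram13 gram_pos[of 3] by (simp add: W_entry)
      then show ?thesis using n by (intro disjI2 exI[of _ 3]) auto
    next
      case 2
      then have "i \<noteq> 2" using k by auto
      then have "W $$ (i, 2) > 0 \<and> W $$ (2, 0) > 0"
        using 2 i k n gram42 gram_pos[of 2] by (simp add: W_entry)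
      then show ?thesis using n by (intro disjI2 exI[of _ 2]) auto
    next
      case 3
      then show ?thesis using i n gram_pos[of "i mod k"] by (simp add: W_entry)
    qed
  qed
  have neighbour: "\<exists>j<n. W $$ (i, j) > 0" if "i < n" for i
  proof (cases "i = 0")
    case True
    have "W $$ (0, k) > 0" using n k gram_pos[of 0] by (simp add: W_entry)
    then show ?thesis using True n by blast
  next
    case False
    then show ?thesis using hub[OF that] n by (meson le_less_trans not_le zero_le)
  qed
  have inst: "maxcut_instance n W"
    unfolding maxcut_instance_def
    using n W Wsym neighbour pentagon_gram_nonneg[OF assms]
    by (auto simp: support_graph_def W_entry)
  have conn: "connected (with_proj (support_graph n W))"
    using n by (intro connected_support_graph W Wsym hub) auto
  have relV: "vec k (\<lambda>a. of_int (u a)) \<in> mat_kernel V" if "u \<in> {pentagon_rel1, pentagon_rel2}" for u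
    using that k by (intro pentagon_relations[OF V]) (auto simp: V_def pentagon_mat_def k_def)
  have bound: "\<bar>u a\<bar> \<le> int 2" if "u \<in> {pentagon_rel1, pentagon_rel2}" for u a
    using that by (auto simp: pentagon_rel1_def pentagon_rel2_def)
  have kernel_span: "mat_kernel B = vec_span n (sign_vecs n \<inter> mat_kernel B)"
    unfolding B_def n_def
  proof (rule blow_up_kernel_spanned_by_signs[OF V, of 2 "{pentagon_rel1, pentagon_rel2}"])
    show "vec k (\<lambda>a. of_int (u a)) \<in> mat_kernel V" if "u \<in> {pentagon_rel1, pentagon_rel2}" for u
      using that by (rule relV)
    show "mat_kernel V \<subseteq> vec_span k ((\<lambda>u. vec k (\<lambda>a. of_int (u a))) ` {pentagon_rel1, pentagon_rel2})"
      using kernel_pentagon_mat[OF assms] by (simp add: V_def k_def)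
    show "\<bar>u a\<bar> \<le> int 2" if "u \<in> {pentagon_rel1, pentagon_rel2}" for u a
      using that by (rule bound)
  qed simp
  have x0: "threshold_signs 2 k pentagon_rel1 \<in> sign_vecs n" "threshold_signs 2 k pentagon_rel1 \<in> mat_kernel Z"
    unfolding n_def kernel B_def
    by (rule threshold_signs_sign_vec, rule threshold_signs_in_kernel[OF V relV bound]) simp_all
  have s: "s \<in> carrier_vec n" by (simp add: s_def)
  note exact = exact_from_gram_slack[OF inst s B, unfolded slack, OF Z_def x0]
  have rank: "vec_space.rank n Z = d"
    unfolding Z_def
  proof (rule rank_gram[OF B])
    \<comment> \<open>Unit vector \<open>c\<close> is column \<open>p c\<close>, from which column \<open>0\<close> is subtracted if
      \<open>c \<ge> 2\<close>.\<close>
    define p where "p c = (if c \<le> 2 then c else c + 2)" for c :: nat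
    define R where "R = mat n d (\<lambda>(j, c). (if j = p c then 1 else 0) - (if j = 0 \<and> 2 \<le> c then 1 else 0 :: real))"
    show "R \<in> carrier_mat n d" by (simp add: R_def)
    show "B * R = 1\<^sub>m d"
    proof (rule eq_matI)
      fix r c assume "r < dim_row (1\<^sub>m d :: real mat)" "c < dim_col (1\<^sub>m d :: real mat)"
      then have rc: "r < d" "c < d" by auto
      have p: "p c < k" using rc assms by (auto simp: p_def k_def)
      have "(B * R) $$ (r, c) = (\<Sum>j<n. (if j = p c then B $$ (r, j) else 0)
          - (if j = 0 then if 2 \<le> c then B $$ (r, j) else 0 else 0))"
        using B rc by (simp add: R_def scalar_prod_def atLeast0LessThan)
          (intro sum.cong refl, auto)
      also have "\<dots> = B $$ (r, p c) - (if 2 \<le> c then B $$ (r, 0) else 0)"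
        using p n by (simp add: sum_subtractf)
      also have "\<dots> = (1\<^sub>m d) $$ (r, c)"
        using rc p n by (auto simp: B_entry pentagon_entry_def p_def)
      finally show "(B * R) $$ (r, c) = (1\<^sub>m d) $$ (r, c)" .
    qed (use B in \<open>auto simp: R_def\<close>)
  qed
  have not_cp: "\<not> completely_positive n Z"
  proof (rule pentagon_not_completely_positive[OF n(1)])
    have rels: "vec n (\<lambda>j. of_int (u j)) \<in> mat_kernel Z" if "u \<in> {pentagon_rel1, pentagon_rel2}" for u
      unfolding kernel using that n k by (intro pentagon_relations[OF B]) (auto simp: B_entry)
    then show "vec n (\<lambda>j. of_int (pentagon_rel1 j)) \<in> mat_kernel Z" "vec n (\<lambda>j. of_int (pentagon_rel2 j)) \<in> mat_kernel Z"
      by auto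
  qed (use n k in \<open>auto simp: Z_entry pentagon_gram_head(2)[OF assms] pentagon_entry_def\<close>)
  show ?thesis
  proof (intro exI conjI)
    show "exact_instance n W" by (rule exact(1))
    show "connected (with_proj (support_graph n W))" by (rule conn)
    show "is_optimal_dual_slack n W Z" by (rule exact(2))
    show "vec_space.rank n Z = d" by (rule rank)
    show "\<not> completely_positive n Z" by (rule not_cp)
    show "sign_vecs n \<inter> mat_kernel Z \<subseteq> optimal_cuts n W" using exact(3) by simp
    show "mat_kernel Z = vec_span n (sign_vecs n \<inter> mat_kernel Z)"
      unfolding kernel by (rule kernel_span)
  qed
qed

end
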